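(* For every integer $n\ge 3$, there exist susceptance values $b_{km}$ on the edges of the cycle graph $C_n$ for which the lossless, zero-injection power flow equations of $C_n$ have exactly $n\binom{n-1}{\lfloor (n-1)/2\rfloor}$ real solutions $(x_1,\dots,x_{n-1},y_1,\dots,y_{n-1})\in\mathbb{R}^{2(n-1)}$.
   Context: A power network on $n$ nodes is a connected undirected graph $G=(V,E)$ with $V=\{v_0,\dots,v_{n-1}\}$. Each edge $v_kv_m\in E$ carries a nonzero real susceptance $b_{km}=b_{mk}$, and $b_{km}=0$ if $v_k$ and $v_m$ are not adjacent. The (lossless, zero-injection, unit-voltage) power flow equations of $G$ with these susceptances are the $2(n-1)$ polynomial equations, for $k=1,\dots,n-1$, $$x_k^2+y_k^2=1,\qquad \sum_{m=0}^{n-1} b_{km}(x_ky_m-x_my_k)=0,$$ in the variables $x_1,\dots,x_{n-1},y_1,\dots,y_{n-1}$, where $x_0=1$ and $y_0=0$ are fixed (the slack node). All real solutions are counted, including the $2^{n-1}$ trivial ones with all $y_k=0$ and $x_k=\pm1$. The cycle graph $C_n$ has edges $v_kv_{k+1}$ with indices modulo $n$. The number $n\binom{n-1}{\lfloor (n-1)/2\rfloor}$ is the known generic maximum number of complex solutions for $C_n$. *)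

theory Defs
  imports Complex_Main "HOL-Library.FuncSet"
begin

text \<open>Nodes are \<open>{..<n}\<close>, node \<open>0\<close> being the slack node; an undirected edge is a two-element set
  of nodes. The susceptance \<open>b k m\<close> is only meaningful for \<open>k, m < n\<close>.\<close>

definition connected_graph :: "nat \<Rightarrow> nat set set \<Rightarrow> bool" where
  "connected_graph n E \<longleftrightarrow>
     (\<forall>e\<in>E. e \<subseteq> {..<n} \<and> card e = 2) \<and>
     (\<forall>k<n. \<forall>m<n. (k, m) \<in> {(i, j). {i, j} \<in> E}\<^sup>*)"

definition power_network :: "nat \<Rightarrow> nat set set \<Rightarrow> (nat \<Rightarrow> nat \<Rightarrow> real) \<Rightarrow> bool" where
  "power_network n E b \<longleftrightarrow>
     connected_graph n E \<and>
     (\<forall>k<n. \<forall>m<n. b k m = b m k) \<and>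
     (\<forall>k<n. \<forall>m<n. if {k, m} \<in> E then b k m \<noteq> 0 else b k m = 0)"

definition cycle_edges :: "nat \<Rightarrow> nat set set" where
  "cycle_edges n = {{k, (k + 1) mod n} | k. k < n}"

definition power_flow_equations ::
    "nat \<Rightarrow> (nat \<Rightarrow> nat \<Rightarrow> real) \<Rightarrow> (nat \<Rightarrow> real) \<Rightarrow> (nat \<Rightarrow> real) \<Rightarrow> bool" where
  "power_flow_equations n b x y \<longleftrightarrow>
     (\<forall>k\<in>{1..<n}. (x k)\<^sup>2 + (y k)\<^sup>2 = 1 \<and>
        (\<Sum>m = 0..<n. b k m * (x k * y m - x m * y k)) = 0)"

text \<open>A point of \<open>\<real>\<^sup>2\<^sup>(\<^sup>n\<^sup>-\<^sup>1\<^sup>)\<close> is a pair of functions that are \<open>undefined\<close> outside \<open>{1..<n}\<close>, so that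
  distinct elements of the solution set differ in some actual coordinate; the updates at \<open>0\<close> supply
  the fixed values at the slack node.\<close>

definition power_flow_solutions ::
    "nat \<Rightarrow> (nat \<Rightarrow> nat \<Rightarrow> real) \<Rightarrow> ((nat \<Rightarrow> real) \<times> (nat \<Rightarrow> real)) set" where
  "power_flow_solutions n b =
     {(x, y). x \<in> extensional {1..<n} \<and> y \<in> extensional {1..<n} \<and>
        power_flow_equations n b (x(0 := 1)) (y(0 := 0))}"

end

theory Submission imports Defs begin

text \<open>
  Put \<open>z\<^sub>k = x\<^sub>k + \<i> y\<^sub>k\<close>, a point of the unit circle, and pass to the ratios
  \<open>w\<^sub>k = z\<^sub>k\<^sub>+\<^sub>1 / z\<^sub>k\<close> across the edges of the cycle. The equation at a node says that the flow
  \<open>\<beta>\<^sub>k Im w\<^sub>k\<close> entering it equals the flow leaving it, so all edges carry the same flow; the ratios come from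
  a potential \<open>z\<close> with \<open>z\<^sub>0 = 1\<close> exactly when their product around the cycle is \<open>1\<close>
  (\<open>bij_betw_solutions_flow_loops\<close>).

  \<^bold>\<open>Odd cycles.\<close> All susceptances equal to \<open>1\<close> work. If the common value of \<open>Im w\<^sub>k\<close> is
  \<open>sin t\<close> with \<open>\<bar>t\<bar> < \<pi>/2\<close>, then each edge has angle \<open>t\<close> or \<open>\<pi> - t\<close>. If \<open>M\<close> is the set of
  edges of the second kind and \<open>m\<close> its size, then the angles add up to a multiple of \<open>2\<pi>\<close> if and only
  if \<open>(n - 2m) t = j\<pi>\<close> for an integer \<open>j \<equiv> m\<close> modulo \<open>2\<close>. As \<open>n - 2m\<close> is odd, hence nonzero,
  the solutions \<open>t\<close> correspond to the \<open>j\<close> of that parity with \<open>\<bar>2j\<bar> < \<bar>n - 2m\<bar>\<close>. Replacing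
  \<open>M\<close> by its complement turns one parity condition into the other, and both together admit
  \<open>\<bar>n - 2m\<bar>\<close> values of \<open>j\<close>. The number of solutions is therefore half of
  \<open>\<Sum>\<^sub>m (n choose m) \<bar>n - 2m\<bar>\<close>, and this sum telescopes (\<open>sum_card_admissible_turns\<close>).

  \<^bold>\<open>Even cycles.\<close> Equal susceptances would now be degenerate: for \<open>n = 2m\<close> the condition reads
  \<open>0 = j\<pi>\<close> and holds for every \<open>t\<close> or for none. Instead one edge gets susceptance \<open>2\<close>,
  which leaves the odd number \<open>N = n - 1\<close> of unit edges. The angle of the strong edge is
  \<open>\<alpha> = arcsin (sin t / 2)\<close> or \<open>\<pi> - \<alpha>\<close>. Adding \<open>\<plusminus>\<alpha>\<close> to \<open>(N - 2m) t\<close> changes nothing in the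
  count above: \<open>\<bar>d\<alpha>/dt\<bar> < 1\<close> keeps the function strictly monotone, and \<open>\<bar>\<alpha>\<bar> < \<pi>/2\<close> keeps its values at
  \<open>\<plusminus>\<pi>/2\<close> between the same multiples of \<open>\<pi>\<close>
  (\<open>bij_betw_branch_angle\<close>). Each of the two choices for the strong edge thus contributes
  \<open>N (N-1 choose (N-1)/2)\<close> solutions, and twice this number is \<open>n (n-1 choose \<lfloor>(n-1)/2\<rfloor>)\<close>.

  The two cases are treated together by \<open>card_unit_loops\<close>, which counts the states of an odd number of
  unit edges closed up by one further edge whose sine is that of the others times \<open>e\<close>;
  for odd cycles \<open>e = 0\<close>, so that the further edge is trivial.
\<close>

section \<open>From node voltages to edge ratios\<close>

definition cycle_susceptance :: "nat \<Rightarrow> (nat \<Rightarrow> real) \<Rightarrow> nat \<Rightarrow> nat \<Rightarrow> real" where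
  "cycle_susceptance n \<beta> k m =
     (if m = (k + 1) mod n then \<beta> k else if k = (m + 1) mod n then \<beta> m else 0)"

text \<open>On a cycle of length at least \<open>3\<close> no edge joins two nodes in both directions, so the two cases in the
  definition of the susceptances never compete.\<close>
lemma successor_asym:
  fixes n k m :: nat
  assumes "n \<ge> 3" "k < n" "m < n" "m = (k + 1) mod n"
  shows "k \<noteq> (m + 1) mod n"
  using assms by (auto simp: mod_Suc split: if_splits)

lemma mem_cycle_edges_iff:
  assumes "k < n" "m < n"
  shows "{k, m} \<in> cycle_edges n \<longleftrightarrow> m = (k + 1) mod n \<or> k = (m + 1) mod n"
  using assms by (auto simp: cycle_edges_def doubleton_eq_iff)

lemma connected_cycle:
  assumes "n \<ge> 3"
  shows "connected_graph n (cycle_edges n)"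
  unfolding connected_graph_def
proof (intro conjI ballI allI impI)
  fix e assume "e \<in> cycle_edges n"
  then obtain k where k: "k < n" "e = {k, (k + 1) mod n}" by (auto simp: cycle_edges_def)
  moreover have "k \<noteq> (k + 1) mod n" using k(1) assms by (auto simp: mod_Suc)
  ultimately show "e \<subseteq> {..<n}" "card e = 2" by auto
next
  let ?r = "{(i, j). {i, j} \<in> cycle_edges n}"
  have "sym ?r" by (auto simp: sym_def insert_commute)
  then have sym: "sym (?r\<^sup>*)" by (rule sym_rtrancl)
  have from0: "(0, k) \<in> ?r\<^sup>*" if "k < n" for k
    using that
  proof (induction k)
    case (Suc k)
    then have "(k, Suc k) \<in> ?r" using mem_cycle_edges_iff[of k n "Suc k"] by simp
    then show ?case using Suc by (meson Suc_lessD rtrancl.rtrancl_into_rtrancl)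
  qed simp
  fix k m assume "k < n" "m < n"
  then show "(k, m) \<in> ?r\<^sup>*" using from0 sym by (meson rtrancl_trans symD)
qed

lemma power_network_cycle:
  assumes "n \<ge> 3" "\<And>k. k < n \<Longrightarrow> \<beta> k \<noteq> 0"
  shows "power_network n (cycle_edges n) (cycle_susceptance n \<beta>)"
  unfolding power_network_def
  using connected_cycle[OF assms(1)] assms(2) successor_asym[OF assms(1)]
  by (auto simp: cycle_susceptance_def mem_cycle_edges_iff)

text \<open>The states of a cycle in terms of its edges: the flows all agree, and the unit ratios multiply to \<open>1\<close>, which is
  Kirchhoff's voltage law in multiplicative form.\<close>
definition flow_loops :: "nat \<Rightarrow> (nat \<Rightarrow> real) \<Rightarrow> (nat \<Rightarrow> complex) set" where
  "flow_loops n \<beta> = {w \<in> extensional {..<n}. (\<forall>k<n. norm (w k) = 1) \<and> (\<Prod>k<n. w k) = 1 \<and>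
     (\<forall>k<n. \<beta> k * Im (w k) = \<beta> 0 * Im (w 0))}"

definition phasor :: "(nat \<Rightarrow> real) \<times> (nat \<Rightarrow> real) \<Rightarrow> nat \<Rightarrow> complex" where
  "phasor = (\<lambda>(x, y) k. Complex ((x(0 := 1)) k) ((y(0 := 0)) k))"

definition edge_ratios :: "nat \<Rightarrow> (nat \<Rightarrow> complex) \<Rightarrow> nat \<Rightarrow> complex" where
  "edge_ratios n z = (\<lambda>k\<in>{..<n}. z ((k + 1) mod n) * cnj (z k))"

text \<open>Integrating the ratios along the path from the slack node recovers the voltages; the restrictions match the
  convention for coordinates outside \<open>{1..<n}\<close>.\<close>
definition partial_products :: "nat \<Rightarrow> (nat \<Rightarrow> complex) \<Rightarrow> (nat \<Rightarrow> real) \<times> (nat \<Rightarrow> real)" where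
  "partial_products n w = (\<lambda>k\<in>{1..<n}. Re (\<Prod>i<k. w i), \<lambda>k\<in>{1..<n}. Im (\<Prod>i<k. w i))"

lemma unit_mult_cnj: "norm z = 1 \<Longrightarrow> z * cnj z = 1" for z :: complex
  by (simp add: complex_norm_square[symmetric])

lemma unit_cancel:
  fixes u z :: complex
  assumes "norm z = 1" shows "z * (u * cnj z) = u"
  using unit_mult_cnj[OF assms] by (simp add: algebra_simps)

lemma prod_edge_ratios:
  assumes "\<And>k. k < n \<Longrightarrow> norm (z k) = 1" "z 0 = 1" "k < n"
  shows "(\<Prod>i<k. edge_ratios n z i) = z k"
  using assms(3)
proof (induction k)
  case (Suc k)
  then have "edge_ratios n z k = z (Suc k) * cnj (z k)" by (simp add: edge_ratios_def)
  then show ?case using Suc assms(1)[of k] unit_cancel[of "z k"] by simp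
qed (simp add: assms)

lemma prod_edge_ratios_closed:
  assumes "\<And>k. k < n \<Longrightarrow> norm (z k) = 1" "z 0 = 1" "n > 0"
  shows "(\<Prod>i<n. edge_ratios n z i) = 1"
proof -
  obtain m where m: "n = Suc m" using assms(3) gr0_conv_Suc by blast
  have "edge_ratios n z m = z 0 * cnj (z m)" by (simp add: m edge_ratios_def)
  then show ?thesis using prod_edge_ratios[of n z m] unit_cancel[of "z m" "z 0"] assms
    by (simp add: m)
qed

text \<open>Since \<open>x\<^sub>k y\<^sub>m - x\<^sub>m y\<^sub>k = Im (z\<^sub>m * cnj z\<^sub>k)\<close> is antisymmetric, the two neighbours of \<open>k\<close> contribute the
  flow on the outgoing edge and minus the flow on the incoming one.\<close>
lemma sum_cycle_susceptance:
  fixes z :: "nat \<Rightarrow> complex"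
  assumes "n \<ge> 3" "k \<in> {1..<n}"
  shows "(\<Sum>m = 0..<n. cycle_susceptance n \<beta> k m * (Re (z k) * Im (z m) - Re (z m) * Im (z k))) =
     \<beta> k * Im (edge_ratios n z k) - \<beta> (k - 1) * Im (edge_ratios n z (k - 1))"
proof -
  let ?h = "\<lambda>m. cycle_susceptance n \<beta> k m * (Re (z k) * Im (z m) - Re (z m) * Im (z k))"
  have nz: "cycle_susceptance n \<beta> k m = 0" if "m < n" "m \<noteq> (k + 1) mod n" "m \<noteq> k - 1" for m
    using that assms by (auto simp: cycle_susceptance_def mod_Suc split: if_splits)
  have ne: "k - 1 \<noteq> (k + 1) mod n" using assms by (auto simp: mod_Suc)
  have "(\<Sum>m = 0..<n. ?h m) = (\<Sum>m\<in>{(k + 1) mod n, k - 1}. ?h m)"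
    using assms nz by (intro sum.mono_neutral_right) auto
  also have "\<dots> = ?h ((k + 1) mod n) + ?h (k - 1)" using ne by simp
  also have "cycle_susceptance n \<beta> k (k - 1) = \<beta> (k - 1)"
    using assms ne by (auto simp: cycle_susceptance_def)
  also have "cycle_susceptance n \<beta> k ((k + 1) mod n) = \<beta> k"
    by (simp add: cycle_susceptance_def)
  finally show ?thesis using assms by (auto simp: edge_ratios_def algebra_simps)
qed

text \<open>The equations at the nodes \<open>1, \<dots>, n - 1\<close> chain all \<open>n\<close> edge flows together, so balance at the slack node
  comes for free.\<close>
lemma power_flow_solutions_cycle_iff:
  assumes "n \<ge> 3"
  shows "p \<in> power_flow_solutions n (cycle_susceptance n \<beta>) \<longleftrightarrow>
     fst p \<in> extensional {1..<n} \<and> snd p \<in> extensional {1..<n} \<and>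
     (\<forall>k<n. norm (phasor p k) = 1) \<and>
     (\<forall>k<n. \<beta> k * Im (edge_ratios n (phasor p) k) = \<beta> 0 * Im (edge_ratios n (phasor p) 0))"
proof -
  obtain x y where p: "p = (x, y)" by force
  let ?z = "phasor p"
  have z: "?z k = Complex ((x(0 := 1)) k) ((y(0 := 0)) k)" for k by (simp add: phasor_def p)
  have z0: "?z 0 = 1" by (simp add: z complex_eq_iff)
  have norm: "norm (?z k) = 1 \<longleftrightarrow> ((x(0 := 1)) k)\<^sup>2 + ((y(0 := 0)) k)\<^sup>2 = 1" for k
    by (simp add: z cmod_def)
  let ?f = "\<lambda>k. \<beta> k * Im (edge_ratios n ?z k)"
  have sum: "(\<Sum>m = 0..<n. cycle_susceptance n \<beta> k m * 
      ((x(0 := 1)) k * (y(0 := 0)) m - (x(0 := 1)) m * (y(0 := 0)) k)) = ?f k - ?f (k - 1)"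
    if "k \<in> {1..<n}" for k
    using sum_cycle_susceptance[OF assms that, of \<beta> ?z] by (simp add: z)
  have const: "(\<forall>k\<in>{1..<n}. ?f k - ?f (k - 1) = 0) \<longleftrightarrow> (\<forall>k<n. ?f k = ?f 0)"
  proof
    assume L: "\<forall>k\<in>{1..<n}. ?f k - ?f (k - 1) = 0"
    have "?f k = ?f 0" if "k < n" for k
      using that
    proof (induction k)
      case (Suc k)
      then show ?case using L[rule_format, of "Suc k"] by simp
    qed simp
    then show "\<forall>k<n. ?f k = ?f 0" by blast
  next
    assume R: "\<forall>k<n. ?f k = ?f 0"
    have "?f k - ?f (k - 1) = 0" if "k \<in> {1..<n}" for k
      using R[rule_format, of k] R[rule_format, of "k - 1"] that by force
    then show "\<forall>k\<in>{1..<n}. ?f k - ?f (k - 1) = 0" by blast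
  qed
  have "(\<forall>k\<in>{1..<n}. norm (?z k) = 1) \<longleftrightarrow> (\<forall>k<n. norm (?z k) = 1)"
    using z0 by (metis One_nat_def Suc_leI atLeastLessThan_iff gr0I norm_one)
  moreover have "power_flow_equations n (cycle_susceptance n \<beta>) (x(0 := 1)) (y(0 := 0)) \<longleftrightarrow>
      (\<forall>k\<in>{1..<n}. norm (?z k) = 1) \<and> (\<forall>k\<in>{1..<n}. ?f k - ?f (k - 1) = 0)"
    unfolding power_flow_equations_def norm using sum by (auto simp del: fun_upd_apply)
  ultimately show ?thesis using const by (simp add: power_flow_solutions_def p)
qed

lemma bij_betw_solutions_flow_loops:
  assumes n: "n \<ge> 3"
  shows "bij_betw (edge_ratios n \<circ> phasor) (power_flow_solutions n (cycle_susceptance n \<beta>)) (flow_loops n \<beta>)"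
proof (rule bij_betw_byWitness[where f' = "partial_products n"])
  let ?S = "power_flow_solutions n (cycle_susceptance n \<beta>)"
  note sol = power_flow_solutions_cycle_iff[OF n]
  have ph0: "phasor p 0 = 1" for p by (cases p) (simp add: phasor_def complex_eq_iff)
  have ph_pp: "phasor (partial_products n w) k = (\<Prod>i<k. w i)" if "k < n" for w k
    using that by (simp add: phasor_def partial_products_def complex_eq_iff)
  have ratios_pp: "edge_ratios n (phasor (partial_products n w)) = w" if w: "w \<in> flow_loops n \<beta>" for w
  proof
    fix k
    show "edge_ratios n (phasor (partial_products n w)) k = w k"
    proof (cases "k < n")
      case True
      have "phasor (partial_products n w) ((k + 1) mod n) = (\<Prod>i<Suc k. w i)"
      proof (cases "Suc k = n")
        case True
        then show ?thesis using w n by (simp add: ph0 flow_loops_def del: prod.lessThan_Suc)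
      next
        case False
        then show ?thesis using \<open>k < n\<close> ph_pp[of "Suc k" w] by simp
      qed
      moreover have "norm (\<Prod>i<k. w i) = 1"
        using w True by (simp add: prod_norm[symmetric] flow_loops_def)
      ultimately show ?thesis using True unit_mult_cnj[of "\<Prod>i<k. w i"]
        by (simp add: edge_ratios_def ph_pp algebra_simps)
    next
      case False
      then show ?thesis using w by (simp add: edge_ratios_def flow_loops_def extensional_def)
    qed
  qed
  then show "\<forall>w\<in>flow_loops n \<beta>. (edge_ratios n \<circ> phasor) (partial_products n w) = w" by simp
  show "\<forall>p\<in>?S. partial_products n ((edge_ratios n \<circ> phasor) p) = p"
  proof
    fix p assume p: "p \<in> ?S"
    obtain x y where xy: "p = (x, y)" by force
    have ext: "x \<in> extensional {1..<n}" "y \<in> extensional {1..<n}" using p by (simp_all add: sol xy)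
    have "(\<Prod>i<k. edge_ratios n (phasor p) i) = phasor p k" if "k < n" for k
      using p that ph0 by (intro prod_edge_ratios) (auto simp: sol)
    then have "partial_products n (edge_ratios n (phasor p)) =
        (\<lambda>k\<in>{1..<n}. Re (phasor p k), \<lambda>k\<in>{1..<n}. Im (phasor p k))"
      by (simp add: partial_products_def cong: restrict_cong)
    also have "\<dots> = (x, y)"
      using ext by (auto simp: phasor_def xy extensional_def fun_eq_iff restrict_def)
    finally show "partial_products n ((edge_ratios n \<circ> phasor) p) = p" by (simp add: xy)
  qed
  show "(edge_ratios n \<circ> phasor) ` ?S \<subseteq> flow_loops n \<beta>"
  proof (rule image_subsetI)
    fix p assume p: "p \<in> ?S"
    have "(\<Prod>i<n. edge_ratios n (phasor p) i) = 1"
      using p ph0 n by (intro prod_edge_ratios_closed) (auto simp: sol)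
    moreover have "norm (edge_ratios n (phasor p) k) = 1" if "k < n" for k
      using p n that by (simp add: edge_ratios_def norm_mult sol)
    moreover have "edge_ratios n (phasor p) \<in> extensional {..<n}" by (simp add: edge_ratios_def)
    moreover have "\<forall>k<n. \<beta> k * Im (edge_ratios n (phasor p) k) = \<beta> 0 * Im (edge_ratios n (phasor p) 0)"
      using p unfolding sol by blast
    ultimately show "(edge_ratios n \<circ> phasor) p \<in> flow_loops n \<beta>"
      unfolding flow_loops_def o_def by blast
  qed
  show "partial_products n ` flow_loops n \<beta> \<subseteq> ?S"
  proof (rule image_subsetI)
    fix w assume w: "w \<in> flow_loops n \<beta>"
    have "norm (phasor (partial_products n w) k) = 1" if "k < n" for k
      using w that by (simp add: ph_pp prod_norm[symmetric] flow_loops_def)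
    moreover have "\<forall>k<n. \<beta> k * Im (w k) = \<beta> 0 * Im (w 0)"
      using w unfolding flow_loops_def by blast
    moreover have "fst (partial_products n w) \<in> extensional {1..<n}"
      "snd (partial_products n w) \<in> extensional {1..<n}" by (simp_all add: partial_products_def)
    ultimately show "partial_products n w \<in> ?S"
      unfolding sol ratios_pp[OF w] by blast
  qed
qed

section \<open>The total angle as a function of the flow\<close>

text \<open>The angles of all edges add up to this function of \<open>t\<close>, up to a multiple of \<open>\<pi>\<close>: \<open>r\<close> is the number of edges
  of angle \<open>t\<close> minus the number of edges of angle \<open>\<pi> - t\<close>, and the last summand comes from the closing edge,
  whose sine is \<open>e\<close> times that of the others.\<close>
definition branch_angle :: "int \<Rightarrow> real \<Rightarrow> real \<Rightarrow> real \<Rightarrow> real" where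
  "branch_angle r s e t = of_int r * t + s * arcsin (e * sin t)"

lemma abs_scaled_sin_less_1:
  fixes e t :: real
  assumes "\<bar>e\<bar> < 1"
  shows "\<bar>e * sin t\<bar> < 1"
proof -
  have "\<bar>e\<bar> * \<bar>sin t\<bar> \<le> \<bar>e\<bar> * 1" by (intro mult_left_mono) auto
  then show ?thesis using assms by (simp add: abs_mult)
qed

lemma branch_angle_has_derivative:
  assumes "\<bar>e\<bar> < 1"
  shows "(branch_angle r s e has_real_derivative
            of_int r + s * (e * cos t / sqrt (1 - (e * sin t)\<^sup>2))) (at t)"
  unfolding branch_angle_def using abs_scaled_sin_less_1[OF assms, of t]
  by (auto intro!: derivative_eq_intros simp: field_simps abs_less_iff)

text \<open>This is where the closing edge has to be stronger than the others. Since
  \<open>(e cos t)\<^sup>2 + (e sin t)\<^sup>2 = e\<^sup>2 < 1\<close>, its angle varies more slowly than \<open>t\<close>, whereas the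
  remaining edges contribute the nonzero integer slope \<open>r\<close>.\<close>
lemma branch_angle_derivative_correction:
  fixes e t :: real
  assumes "\<bar>e\<bar> < 1"
  shows "\<bar>e * cos t / sqrt (1 - (e * sin t)\<^sup>2)\<bar> < 1"
proof -
  have "(e * sin t)\<^sup>2 < 1"
    using abs_scaled_sin_less_1[OF assms, of t] by (simp add: abs_square_less_1)
  have "(e * cos t)\<^sup>2 + (e * sin t)\<^sup>2 = e\<^sup>2"
    by (simp add: power_mult_distrib flip: distrib_left)
  moreover have "e\<^sup>2 < 1" using assms by (simp add: abs_square_less_1)
  ultimately have "\<bar>e * cos t\<bar> < sqrt (1 - (e * sin t)\<^sup>2)"
    by (intro real_less_rsqrt) simp
  then show ?thesis
    using \<open>(e * sin t)\<^sup>2 < 1\<close> by (simp add: abs_divide)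
qed

lemma strict_mono_branch_angle:
  assumes "\<bar>e\<bar> < 1" "\<bar>s\<bar> \<le> 1" "r \<ge> 1"
  shows "strict_mono (branch_angle r s e)"
proof (rule strict_monoI)
  fix a b :: real
  assume "a < b"
  then show "branch_angle r s e a < branch_angle r s e b"
  proof (rule DERIV_pos_imp_increasing)
    fix t
    let ?d = "e * cos t / sqrt (1 - (e * sin t)\<^sup>2)"
    have "\<bar>s * ?d\<bar> \<le> 1 * \<bar>?d\<bar>"
      unfolding abs_mult using assms(2) by (intro mult_right_mono) auto
    also have "\<dots> < 1" using branch_angle_derivative_correction[OF assms(1)] by simp
    finally have "- 1 < s * ?d" unfolding abs_less_iff by linarith
    moreover have "1 \<le> real_of_int r" using assms(3) by simp
    ultimately have "of_int r + s * ?d > 0" by linarith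
    then show "\<exists>y. (branch_angle r s e has_real_derivative y) (at t) \<and> 0 < y"
      using branch_angle_has_derivative[OF assms(1)] by blast
  qed
qed

lemma branch_angle_minus: "branch_angle (- r) (- s) e t = - branch_angle r s e t"
  by (simp add: branch_angle_def)

lemma branch_angle_at_end:
  assumes "\<bar>e\<bar> < 1" "\<bar>s\<bar> \<le> 1"
  shows "\<bar>branch_angle r s e (pi/2) - of_int r * (pi/2)\<bar> < pi/2"
proof -
  have "\<bar>arcsin e\<bar> < pi/2" using arcsin_lt_bounded[of e] assms(1) by (auto simp: abs_less_iff)
  moreover have "\<bar>s * arcsin e\<bar> \<le> 1 * \<bar>arcsin e\<bar>"
    unfolding abs_mult using assms(2) by (intro mult_right_mono) auto
  ultimately show ?thesis by (simp add: branch_angle_def)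
qed

lemma branch_angle_odd: 
  assumes "\<bar>e\<bar> < 1" shows "branch_angle r s e (-t) = - branch_angle r s e t"
  using abs_scaled_sin_less_1[OF assms, of t] by (simp add: branch_angle_def arcsin_minus abs_less_iff)

text \<open>At \<open>\<pi>/2\<close> the function lies strictly between \<open>(r - 1)\<pi>/2\<close> and \<open>(r + 1)\<pi>/2\<close>, which are consecutive
  multiples of \<open>\<pi>\<close> because \<open>r\<close> is odd. So the multiples it attains are those of absolute value at most
  \<open>(r - 1)\<pi>/2\<close>, whatever the contribution of the closing edge.\<close>
lemma branch_angle_hits_multiple_of_pi_iff:
  assumes e: "\<bar>e\<bar> < 1" and s: "\<bar>s\<bar> \<le> 1" and r: "r \<ge> 1" "odd r"
  shows "(\<exists>t. \<bar>t\<bar> < pi/2 \<and> branch_angle r s e t = of_int j * pi) \<longleftrightarrow> \<bar>2 * j\<bar> < \<bar>r\<bar>"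
proof -
  let ?g = "branch_angle r s e"
  have mono: "strict_mono ?g" using strict_mono_branch_angle e s r by blast
  have odd: "?g (- (pi/2)) = - ?g (pi/2)" using branch_angle_odd[OF e] .
  define d where "d = ?g (pi/2) - of_int r * (pi/2)"
  have d: "\<bar>d\<bar> < pi/2" unfolding d_def using branch_angle_at_end[OF e s] .
  have end_bounds: "of_int (r - 1) * pi / 2 < ?g (pi/2)" "?g (pi/2) < of_int (r + 1) * pi / 2"
    using d unfolding d_def by (auto simp: abs_less_iff field_simps)
  show ?thesis
  proof
    assume "\<exists>t. \<bar>t\<bar> < pi/2 \<and> ?g t = of_int j * pi"
    then obtain t where t: "\<bar>t\<bar> < pi/2" "?g t = of_int j * pi" by blast
    have "?g t < ?g (pi/2)" "?g (- (pi/2)) < ?g t"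
      using t(1) by (auto intro!: strict_monoD[OF mono] simp: abs_less_iff)
    then have "of_int j * pi < of_int (r + 1) * pi / 2" "- (of_int j * pi) < of_int (r + 1) * pi / 2"
      using end_bounds t(2) odd by linarith+
    then have "(of_int (2 * j) :: real) * pi < of_int (r + 1) * pi" 
        "(of_int (- 2 * j) :: real) * pi < of_int (r + 1) * pi"
      by simp_all
    then have "2 * j < r + 1" "- 2 * j < r + 1"
      by (simp_all only: mult_less_cancel_right_pos pi_gt_zero of_int_less_iff)
    then show "\<bar>2 * j\<bar> < \<bar>r\<bar>" using r by presburger
  next
    assume "\<bar>2 * j\<bar> < \<bar>r\<bar>"
    then have "2 * j \<le> r - 1" "- 2 * j \<le> r - 1" using r by presburger+
    then have "(of_int (2 * j) :: real) * pi \<le> of_int (r - 1) * pi" 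
        "(of_int (- 2 * j) :: real) * pi \<le> of_int (r - 1) * pi"
      by (simp_all only: mult_le_cancel_right_pos pi_gt_zero of_int_le_iff)
    then have j: "of_int j * pi < ?g (pi/2)" "?g (- (pi/2)) < of_int j * pi"
      using end_bounds odd by (simp_all only: of_int_mult of_int_minus of_int_numeral)
    have "\<exists>t\<ge>- (pi/2). t \<le> pi/2 \<and> ?g t = of_int j * pi"
      using j branch_angle_has_derivative[OF e]
      by (intro IVT) (auto intro: DERIV_isCont)
    then obtain t where t: "- (pi/2) \<le> t" "t \<le> pi/2" "?g t = of_int j * pi" by blast
    then have "t \<noteq> pi/2" "t \<noteq> - (pi/2)" using j by fastforce+
    then show "\<exists>t. \<bar>t\<bar> < pi/2 \<and> ?g t = of_int j * pi" using t by (intro exI[of _ t]) auto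
  qed
qed

text \<open>Negating \<open>r\<close> and \<open>s\<close> negates the function, which reduces negative \<open>r\<close> to positive \<open>r\<close>. Where the function
  is a multiple of \<open>\<pi>\<close>, the floor is just a way to name the integer factor.\<close>
lemma bij_betw_branch_angle:
  assumes e: "\<bar>e\<bar> < 1" and s: "\<bar>s\<bar> \<le> 1" and "odd r"
  shows "bij_betw (\<lambda>t. \<lfloor>branch_angle r s e t / pi\<rfloor>)
           {t. \<bar>t\<bar> < pi/2 \<and> (\<exists>j. branch_angle r s e t = of_int j * pi \<and> P j)}
           {j. \<bar>2 * j\<bar> < \<bar>r\<bar> \<and> P j}"
proof -
  have main: "inj (branch_angle r s e) \<and> (\<forall>j. (\<exists>t. \<bar>t\<bar> < pi/2 \<and> branch_angle r s e t = of_int j * pi) \<longleftrightarrow> \<bar>2 * j\<bar> < \<bar>r\<bar>)"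
  proof (cases "r \<ge> 1")
    case True
    then show ?thesis
      using branch_angle_hits_multiple_of_pi_iff[OF e s True] \<open>odd r\<close>
        strict_mono_imp_inj_on[OF strict_mono_branch_angle[OF e s True]] by simp
  next
    case False
    then have r': "- r \<ge> 1" "odd (- r)" using \<open>odd r\<close> by presburger+
    have s': "\<bar>- s\<bar> \<le> 1" using s by simp
    have "inj (branch_angle (- r) (- s) e)"
      by (rule strict_mono_imp_inj_on[OF strict_mono_branch_angle[OF e s' r'(1)]])
    then have "inj (branch_angle r s e)"
      by (simp add: inj_def branch_angle_minus)
    moreover have "(\<exists>t. \<bar>t\<bar> < pi/2 \<and> branch_angle r s e t = of_int j * pi) \<longleftrightarrow> \<bar>2 * j\<bar> < \<bar>r\<bar>" for j
      using branch_angle_hits_multiple_of_pi_iff[OF e s' r', of "- j"] by (simp add: branch_angle_minus)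
    ultimately show ?thesis by blast
  qed
  have floor: "\<lfloor>branch_angle r s e t / pi\<rfloor> = j" if "branch_angle r s e t = of_int j * pi" for t j
    using that by simp
  show ?thesis
    unfolding bij_betw_def
  proof
    show "inj_on (\<lambda>t. \<lfloor>branch_angle r s e t / pi\<rfloor>)
           {t. \<bar>t\<bar> < pi/2 \<and> (\<exists>j. branch_angle r s e t = of_int j * pi \<and> P j)}"
      using main by (auto simp: inj_on_def inj_def floor)
    show "(\<lambda>t. \<lfloor>branch_angle r s e t / pi\<rfloor>) ` 
           {t. \<bar>t\<bar> < pi/2 \<and> (\<exists>j. branch_angle r s e t = of_int j * pi \<and> P j)} = {j. \<bar>2 * j\<bar> < \<bar>r\<bar> \<and> P j}"
      (is "?f ` ?T = ?J")
    proof
      show "?f ` ?T \<subseteq> ?J" using main by (auto simp: floor)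
      show "?J \<subseteq> ?f ` ?T"
      proof
        fix j assume j: "j \<in> ?J"
        then obtain t where "\<bar>t\<bar> < pi/2" "branch_angle r s e t = of_int j * pi" using main by auto
        then show "j \<in> ?f ` ?T" using j by (intro image_eqI[of _ _ t]) (auto simp: floor)
      qed
    qed
  qed
qed

section \<open>Counting the admissible multiples of \<open>\<pi>\<close>\<close>

text \<open>The sum telescopes because \<open>(N choose m) (N - 2m)\<close> is \<open>N\<close> times the difference of
  \<open>N - 1 choose m\<close> and \<open>N - 1 choose (m - 1)\<close>.\<close>
lemma sum_binomial_linear:
  assumes "N \<ge> 1"
  shows "(\<Sum>m\<le>k. int (N choose m) * (int N - 2 * int m)) = int N * int ((N - 1) choose k)"
proof (induction k)
  case (Suc k)
  have absorb: "int (Suc k) * int (N choose Suc k) = int N * int ((N - 1) choose k)"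
  proof -
    have "Suc k * (N choose Suc k) = N * ((N - 1) choose k)"
      using Suc_times_binomial_eq[of "N - 1" k] assms by (simp add: mult.commute)
    then show ?thesis unfolding of_nat_mult[symmetric] by (rule arg_cong)
  qed
  have "N choose Suc k = ((N - 1) choose k) + ((N - 1) choose Suc k)"
    using assms by (cases N) auto
  then have pascal: "int (N choose Suc k) = int ((N - 1) choose k) + int ((N - 1) choose Suc k)" by simp
  have "int (N choose Suc k) * (int N - 2 * int (Suc k)) =
      int N * int (N choose Suc k) - 2 * (int N * int ((N - 1) choose k))"
    unfolding absorb[symmetric] by (simp add: algebra_simps)
  then show ?case unfolding pascal using Suc.IH pascal by (simp add: algebra_simps)
qed simp

lemma sum_Pow_card:
  fixes f :: "nat \<Rightarrow> 'a :: comm_semiring_1"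
  assumes "finite A"
  shows "(\<Sum>M\<in>Pow A. f (card M)) = (\<Sum>m\<le>card A. of_nat (card A choose m) * f m)"
proof -
  have "(\<Sum>M\<in>Pow A. f (card M)) = (\<Sum>m\<le>card A. \<Sum>M | M \<in> Pow A \<and> card M = m. f (card M))"
    using assms by (intro sum.group[symmetric]) (auto intro: card_mono)
  also have "\<dots> = (\<Sum>m\<le>card A. of_nat (card A choose m) * f m)"
    using n_subsets[OF assms] by (intro sum.cong) (auto simp: conj_commute)
  finally show ?thesis .
qed

text \<open>The summand without absolute value sums to \<open>0\<close> over all \<open>m \<le> N\<close>, so the terms with \<open>m > p\<close>, which are the
  negative ones, contribute as much to the absolute sum as those with \<open>m \<le> p\<close>.\<close>
lemma sum_binomial_abs:
  assumes "N = 2 * p + 1"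
  shows "(\<Sum>m\<le>N. int (N choose m) * \<bar>int N - 2 * int m\<bar>) = 2 * int N * int ((N - 1) choose p)"
proof -
  let ?f = "\<lambda>m. int (N choose m) * (int N - 2 * int m)"
  have split: "sum h {..N} = sum h {..p} + sum h {p<..N}" for h :: "nat \<Rightarrow> int"
  proof -
    have "{..N} = {..p} \<union> {p<..N}" using assms by auto
    then show ?thesis by (simp only:) (rule sum.union_disjoint, auto)
  qed
  have "sum ?f {..N} = 0" "sum ?f {..p} = int N * int ((N - 1) choose p)"
    using sum_binomial_linear[of N] assms by (simp_all add: binomial_eq_0)
  moreover have "(\<Sum>m\<le>p. int (N choose m) * \<bar>int N - 2 * int m\<bar>) = sum ?f {..p}"
    using assms by (intro sum.cong) auto
  moreover have "(\<Sum>m\<in>{p<..N}. int (N choose m) * \<bar>int N - 2 * int m\<bar>) = - sum ?f {p<..N}"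
    using assms unfolding sum_negf[symmetric] by (intro sum.cong) (auto simp: algebra_simps)
  ultimately show ?thesis
    using split[of ?f] split[of "\<lambda>m. int (N choose m) * \<bar>int N - 2 * int m\<bar>"] by simp
qed

text \<open>The integers \<open>j\<close> such that \<open>j\<pi>\<close> can be the value of the branch angle in a state in which \<open>m\<close> of the \<open>N\<close> unit edges have angle \<open>\<pi> - t\<close>.
  Each such edge shifts the sum of all angles by \<open>\<pi>\<close>, and so does the closing edge when its real part is negative,
  which is the case that \<open>\<sigma>\<close> is false; the parity of \<open>j\<close> compensates these shifts.\<close>
definition admissible_turns :: "nat \<Rightarrow> bool \<Rightarrow> nat \<Rightarrow> int set" where
  "admissible_turns N \<sigma> m = {j. \<bar>2 * j\<bar> < \<bar>int N - 2 * int m\<bar> \<and> (even j \<longleftrightarrow> (even m \<longleftrightarrow> \<sigma>))}"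

lemma finite_admissible_turns: "finite (admissible_turns N \<sigma> m)"
  by (rule finite_subset[of _ "{- \<bar>int N - 2 * int m\<bar>..\<bar>int N - 2 * int m\<bar>}"])
     (auto simp: admissible_turns_def)

lemma admissible_turns_card_add:
  assumes "odd N"
  shows "int (card (admissible_turns N True m)) + int (card (admissible_turns N False m)) =
     \<bar>int N - 2 * int m\<bar>"
proof -
  let ?r = "\<bar>int N - 2 * int m\<bar>"
  have "odd ?r" using assms by simp
  then obtain q where q: "?r = 2 * q + 1" by (rule oddE)
  have "admissible_turns N True m \<union> admissible_turns N False m = {-q..q}"
    unfolding admissible_turns_def q by auto
  moreover have "admissible_turns N True m \<inter> admissible_turns N False m = {}"
    unfolding admissible_turns_def by auto
  ultimately have "card (admissible_turns N True m) + card (admissible_turns N False m) = card {-q..q}"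
    using card_Un_disjoint[OF finite_admissible_turns finite_admissible_turns] by metis
  moreover have "int (card {-q..q}) = 2 * q + 1" using q by simp
  ultimately show ?thesis using q by linarith
qed

lemma admissible_turns_complement:
  assumes "odd N" "m \<le> N"
  shows "admissible_turns N \<sigma> (N - m) = admissible_turns N (\<not> \<sigma>) m"
proof -
  have "int N - 2 * int (N - m) = - (int N - 2 * int m)" using assms by simp
  moreover have "even (N - m) \<longleftrightarrow> odd m" using assms by simp
  ultimately show ?thesis unfolding admissible_turns_def by auto
qed

text \<open>Complementing \<open>M\<close> exchanges the two values of \<open>\<sigma>\<close>, because \<open>N\<close> is odd. So both give the same sum, and
  that is half of the sum of \<open>\<bar>N - 2m\<bar>\<close>.\<close>
lemma sum_card_admissible_turns:
  assumes "odd N"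
  shows "(\<Sum>M\<in>Pow {..<N}. card (admissible_turns N \<sigma> (card M))) = N * ((N - 1) choose ((N - 1) div 2))"
proof -
  let ?c = "\<lambda>\<sigma> M. card (admissible_turns N \<sigma> (card M))"
  have swap: "(\<Sum>M\<in>Pow {..<N}. ?c True M) = (\<Sum>M\<in>Pow {..<N}. ?c False M)"
  proof (rule sum.reindex_bij_witness[where i="\<lambda>M. {..<N} - M" and j="\<lambda>M. {..<N} - M"])
    fix M assume M: "M \<in> Pow {..<N}"
    then have "card ({..<N} - M) = N - card M" "card M \<le> N"
      using card_Diff_subset[of M "{..<N}"] card_mono[of "{..<N}" M] finite_subset[of M "{..<N}"] by auto
    then show "?c False ({..<N} - M) = ?c True M"
      using admissible_turns_complement[OF assms, of "card M" False] by simp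
  qed auto
  obtain p where p: "N = 2 * p + 1" using assms by (auto elim: oddE)
  have "int (\<Sum>M\<in>Pow {..<N}. ?c True M) + int (\<Sum>M\<in>Pow {..<N}. ?c False M) =
      (\<Sum>M\<in>Pow {..<N}. \<bar>int N - 2 * int (card M)\<bar>)"
    using admissible_turns_card_add[OF assms] by (simp flip: sum.distrib)
  also have "\<dots> = 2 * int N * int ((N - 1) choose p)"
    using sum_Pow_card[of "{..<N}" "\<lambda>m. \<bar>int N - 2 * int m\<bar>"] sum_binomial_abs[OF p] by simp
  finally have "2 * int (\<Sum>M\<in>Pow {..<N}. ?c True M) = 2 * int (N * ((N - 1) choose p))"
    using swap by simp
  then have "(\<Sum>M\<in>Pow {..<N}. ?c True M) = N * ((N - 1) choose p)" by linarith
  then show ?thesis using swap p by (cases \<sigma>) auto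
qed

section \<open>An odd number of unit edges\<close>

text \<open>The point of the unit circle with imaginary part \<open>a\<close> on the right (\<open>s = 1\<close>) or on the left (\<open>s = -1\<close>); in this
  form its angle is visibly \<open>\<plusminus>arcsin a\<close> up to a shift by \<open>\<pi>\<close>.\<close>
definition edge_phasor :: "real \<Rightarrow> real \<Rightarrow> complex" where
  "edge_phasor s a = of_real s * cis (s * arcsin a)"

lemma edge_phasor_parts:
  assumes "s = 1 \<or> s = -1" "\<bar>a\<bar> < 1"
  shows "norm (edge_phasor s a) = 1" "Im (edge_phasor s a) = a" "Re (edge_phasor s a) = s * sqrt (1 - a\<^sup>2)"
  using assms by (auto simp: edge_phasor_def norm_mult cos_arcsin abs_less_iff)

lemma edge_phasor_unique:
  assumes "norm u = 1" "\<bar>Im u\<bar> < 1"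
  shows "u = edge_phasor (if Re u < 0 then -1 else 1) (Im u)"
proof -
  have "(Re u)\<^sup>2 + (Im u)\<^sup>2 = 1" using assms(1) cmod_power2[of u] by simp
  then have "sqrt (1 - (Im u)\<^sup>2) = \<bar>Re u\<bar>" by (metis add_diff_cancel_right' real_sqrt_abs)
  then show ?thesis using edge_phasor_parts[OF _ assms(2)] by (auto simp: complex_eq_iff)
qed

lemma signed_cis_eq_1_iff:
  assumes "s = 1 \<or> s = -1"
  shows "(-1) ^ m * of_real s * cis x = 1 \<longleftrightarrow>
           (\<exists>j. x = of_int j * pi \<and> (even j \<longleftrightarrow> (even m \<longleftrightarrow> s = 1)))"
proof
  assume L: "(-1) ^ m * of_real s * cis x = 1"
  have sign: "(-1) ^ m * complex_of_real s = (if even m \<longleftrightarrow> s = 1 then 1 else -1)"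
    using assms by auto
  have "sin x = 0" using L unfolding sign by (auto simp: complex_eq_iff split: if_splits)
  then obtain j where j: "x = of_int j * pi" by (auto simp: sin_zero_iff_int2)
  moreover have "cos x = (if even j then 1 else -1)" using cos_npi_int[of j] by (simp add: j mult.commute)
  ultimately have "even j \<longleftrightarrow> (even m \<longleftrightarrow> s = 1)"
    using L unfolding sign by (auto simp: complex_eq_iff split: if_splits)
  then show "\<exists>j. x = of_int j * pi \<and> (even j \<longleftrightarrow> (even m \<longleftrightarrow> s = 1))" using j by blast
next
  assume "\<exists>j. x = of_int j * pi \<and> (even j \<longleftrightarrow> (even m \<longleftrightarrow> s = 1))"
  then obtain j where j: "x = of_int j * pi" "even j \<longleftrightarrow> (even m \<longleftrightarrow> s = 1)" by blast
  have "cis x = (if even j then 1 else -1)"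
    using cos_npi_int[of j] sin_npi_int[of j] by (simp add: j(1) complex_eq_iff mult.commute)
  then show "(-1) ^ m * of_real s * cis x = 1" using assms j(2) by auto
qed

text \<open>States of \<open>N\<close> edges of susceptance \<open>1\<close> closed up by one edge of susceptance \<open>1 / e\<close> on its branch \<open>s\<close>. For
  \<open>e = 0\<close> and \<open>s = 1\<close> the closing edge has ratio \<open>1\<close> and may be contracted.\<close>
definition unit_loops :: "nat \<Rightarrow> real \<Rightarrow> real \<Rightarrow> (nat \<Rightarrow> complex) set" where
  "unit_loops N s e = {w \<in> extensional {..<N}. (\<forall>k<N. norm (w k) = 1) \<and>
     (\<forall>k<N. Im (w k) = Im (w 0)) \<and> (\<Prod>k<N. w k) * edge_phasor s (e * Im (w 0)) = 1}"

text \<open>\<open>- cis (- t) = cis (\<pi> - t)\<close>, so \<open>M\<close> lists the edges of angle \<open>\<pi> - t\<close>.\<close>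
definition branch_phasors :: "nat \<Rightarrow> nat set \<times> real \<Rightarrow> nat \<Rightarrow> complex" where
  "branch_phasors N = (\<lambda>(M, t). \<lambda>k\<in>{..<N}. if k \<in> M then - cis (- t) else cis t)"

lemma prod_branch_phasors:
  assumes "M \<subseteq> {..<N}"
  shows "(\<Prod>k<N. branch_phasors N (M, t) k) = (-1) ^ card M * cis (of_int (int N - 2 * int (card M)) * t)"
proof -
  have le: "card M \<le> N" using card_mono[OF _ assms] by simp
  have "(\<Prod>k<N. branch_phasors N (M, t) k) = (\<Prod>k<N. if k \<in> M then - cis (- t) else cis t)"
    by (simp add: branch_phasors_def)
  also have "\<dots> = (- cis (- t)) ^ card M * cis t ^ (N - card M)"
    using assms card_Diff_subset[OF _ assms] finite_subset[OF assms]
    by (subst prod.If_cases) (auto simp: Int_absorb1 Diff_eq[symmetric])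
  also have "\<dots> = (-1) ^ card M * (cis (- t) ^ card M * cis t ^ (N - card M))"
    by (subst power_minus) simp
  also have "cis (- t) ^ card M * cis t ^ (N - card M) = cis (of_int (int N - 2 * int (card M)) * t)"
    unfolding DeMoivre cis_mult using le by (intro arg_cong[of _ _ cis]) (simp add: of_nat_diff algebra_simps)
  finally show ?thesis .
qed

text \<open>At maximal flow each of the \<open>N\<close> edges would have the ratio \<open>\<i>\<close> or each the ratio \<open>-\<i>\<close>. Then their product is
  purely imaginary, as \<open>N\<close> is odd, and so would be the ratio of the closing edge, whose imaginary part however
  has absolute value less than \<open>1\<close>. Hence \<open>t\<close> never reaches \<open>\<plusminus>\<pi>/2\<close>, where the two angles \<open>t\<close> and
  \<open>\<pi> - t\<close> coincide and the parametrization would fail to be injective.\<close>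
lemma unit_loops_Im_less_1:
  assumes "odd N" "s = 1 \<or> s = -1" "\<bar>e\<bar> < 1" and w: "w \<in> unit_loops N s e"
  shows "\<bar>Im (w 0)\<bar> < 1"
proof (rule ccontr)
  assume not: "\<not> \<bar>Im (w 0)\<bar> < 1"
  define c where "c = Im (w 0)"
  have N: "0 < N" using assms(1) by (simp add: odd_pos)
  have "norm (w 0) = 1" using w N by (simp add: unit_loops_def)
  then have "\<bar>c\<bar> = 1" using not abs_Im_le_cmod[of "w 0"] by (simp add: c_def)
  then have c2: "c\<^sup>2 = 1" by (simp add: abs_square_eq_1)
  have "w k = \<i> * of_real c" if "k < N" for k
  proof -
    have "norm (w k) = 1" "Im (w k) = c" using w that unfolding unit_loops_def c_def by blast+
    then have "(Re (w k))\<^sup>2 = 0" using cmod_power2[of "w k"] c2 by simp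
    then show ?thesis using \<open>Im (w k) = c\<close> by (simp add: complex_eq_iff)
  qed
  then have "(\<Prod>k<N. w k) = (\<i> * of_real c) ^ N" by simp
  moreover obtain p where "N = 2 * p + 1" using assms(1) by (rule oddE)
  moreover have "(\<i> * complex_of_real c)\<^sup>2 = -1"
    using c2 by (simp add: power_mult_distrib flip: of_real_power)
  ultimately have "(\<Prod>k<N. w k) = (-1) ^ p * (\<i> * of_real c)"
    by (simp add: power_mult)
  then have prod: "(\<Prod>k<N. w k) = of_real ((-1) ^ p * c) * \<i>" by simp
  have ec: "\<bar>e * c\<bar> < 1" using \<open>\<bar>c\<bar> = 1\<close> assms(3) by (simp add: abs_mult)
  have "of_real ((-1) ^ p * c) * \<i> * edge_phasor s (e * c) = 1"
    using w unfolding prod[symmetric] unfolding unit_loops_def c_def by blast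
  from arg_cong[OF this, of Re] have "- ((-1) ^ p * c * (e * c)) = 1"
    using edge_phasor_parts(2)[OF assms(2) ec] by simp
  then have "\<bar>(-1) ^ p * c * (e * c)\<bar> = 1" by linarith
  then show False using ec \<open>\<bar>c\<bar> = 1\<close> by (simp add: abs_mult power_abs)
qed

text \<open>Away from maximal flow a ratio with imaginary part \<open>sin t\<close> is determined by the sign of its real part, so a state is
  the same as the set \<open>M\<close> of edges with negative real part together with \<open>t\<close>.\<close>
lemma bij_betw_branch_phasors:
  assumes "odd N" and s: "s = 1 \<or> s = -1" and e: "\<bar>e\<bar> < 1"
  shows "bij_betw (branch_phasors N)
     (SIGMA M:Pow {..<N}. {t. \<bar>t\<bar> < pi/2 \<and> (\<exists>j. branch_angle (int N - 2 * int (card M)) s e t = of_int j * pi \<and>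
        (even j \<longleftrightarrow> (even (card M) \<longleftrightarrow> s = 1)))})
     (unit_loops N s e)" (is "bij_betw _ ?S _")
proof (rule bij_betw_byWitness[where f' = "\<lambda>w. ({k\<in>{..<N}. Re (w k) < 0}, arcsin (Im (w 0)))"])
  have N: "0 < N" using assms(1) by (simp add: odd_pos)
  have Im: "Im (branch_phasors N (M, t) k) = sin t" if "k < N" for M t k
    using that by (simp add: branch_phasors_def)
  have in_loops: "branch_phasors N (M, t) \<in> unit_loops N s e \<longleftrightarrow> (M, t) \<in> ?S"
    if M: "M \<subseteq> {..<N}" and t: "\<bar>t\<bar> < pi/2" for M t
  proof -
    have "branch_phasors N (M, t) \<in> extensional {..<N}" "\<forall>k<N. norm (branch_phasors N (M, t) k) = 1"
      by (auto simp: branch_phasors_def)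
    moreover have "(\<Prod>k<N. branch_phasors N (M, t) k) * edge_phasor s (e * sin t) =
        (-1) ^ card M * of_real s * cis (branch_angle (int N - 2 * int (card M)) s e t)"
      unfolding prod_branch_phasors[OF M] edge_phasor_def branch_angle_def
      by (simp add: cis_mult[symmetric])
    ultimately have "branch_phasors N (M, t) \<in> unit_loops N s e \<longleftrightarrow>
        (-1) ^ card M * of_real s * cis (branch_angle (int N - 2 * int (card M)) s e t) = 1"
      using N by (simp add: unit_loops_def Im)
    then show ?thesis unfolding signed_cis_eq_1_iff[OF s] using M t by simp
  qed
  show "\<forall>p\<in>?S. (\<lambda>w. ({k\<in>{..<N}. Re (w k) < 0}, arcsin (Im (w 0)))) (branch_phasors N p) = p"
  proof
    fix p assume "p \<in> ?S"
    then obtain M t where p: "p = (M, t)" "M \<subseteq> {..<N}" "\<bar>t\<bar> < pi/2" by auto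
    then have "cos t > 0" by (intro cos_gt_zero_pi) auto
    then have "{k\<in>{..<N}. Re (branch_phasors N (M, t) k) < 0} = M"
      using p(2) by (auto simp: branch_phasors_def)
    moreover have "arcsin (Im (branch_phasors N (M, t) 0)) = t"
      using p(3) N by (simp add: Im arcsin_sin abs_less_iff)
    ultimately show "(\<lambda>w. ({k\<in>{..<N}. Re (w k) < 0}, arcsin (Im (w 0)))) (branch_phasors N p) = p"
      by (simp add: p)
  qed
  have inverse: "branch_phasors N ({k\<in>{..<N}. Re (w k) < 0}, arcsin (Im (w 0))) = w \<and> 
      \<bar>arcsin (Im (w 0))\<bar> < pi/2" if w: "w \<in> unit_loops N s e" for w
  proof
    have c: "\<bar>Im (w 0)\<bar> < 1" using unit_loops_Im_less_1[OF assms w] .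
    then show "\<bar>arcsin (Im (w 0))\<bar> < pi/2"
      using arcsin_lt_bounded[of "Im (w 0)"] by (auto simp: abs_less_iff)
    show "branch_phasors N ({k\<in>{..<N}. Re (w k) < 0}, arcsin (Im (w 0))) = w"
    proof
      fix k
      show "branch_phasors N ({k\<in>{..<N}. Re (w k) < 0}, arcsin (Im (w 0))) k = w k"
      proof (cases "k < N")
        case True
        then have "norm (w k) = 1" "Im (w k) = Im (w 0)" using w unfolding unit_loops_def by blast+
        then show ?thesis
          using True c edge_phasor_unique[of "w k"]
          by (cases "Re (w k) < 0") (simp_all add: branch_phasors_def edge_phasor_def)
      next
        case False
        then show ?thesis using w by (simp add: branch_phasors_def unit_loops_def extensional_def)
      qed
    qed
  qed
  then show "\<forall>w\<in>unit_loops N s e. branch_phasors N ({k\<in>{..<N}. Re (w k) < 0}, arcsin (Im (w 0))) = w"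
    by blast
  show "branch_phasors N ` ?S \<subseteq> unit_loops N s e"
    using in_loops by auto
  show "(\<lambda>w. ({k\<in>{..<N}. Re (w k) < 0}, arcsin (Im (w 0)))) ` unit_loops N s e \<subseteq> ?S"
  proof (rule image_subsetI)
    fix w assume w: "w \<in> unit_loops N s e"
    show "({k\<in>{..<N}. Re (w k) < 0}, arcsin (Im (w 0))) \<in> ?S"
      using in_loops[of "{k\<in>{..<N}. Re (w k) < 0}" "arcsin (Im (w 0))"] inverse[OF w] w by auto
  qed
qed

lemma card_unit_loops:
  assumes "odd N" and s: "s = 1 \<or> s = -1" and e: "\<bar>e\<bar> < 1"
  shows "finite (unit_loops N s e) \<and> card (unit_loops N s e) = N * ((N - 1) choose ((N - 1) div 2))"
proof -
  define T where "T M = {t. \<bar>t\<bar> < pi/2 \<and> (\<exists>j. branch_angle (int N - 2 * int (card M)) s e t = of_int j * pi \<and>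
        (even j \<longleftrightarrow> (even (card M) \<longleftrightarrow> s = 1)))}" for M :: "nat set"
  have bij: "bij_betw (\<lambda>t. \<lfloor>branch_angle (int N - 2 * int (card M)) s e t / pi\<rfloor>) (T M)
      (admissible_turns N (s = 1) (card M))" for M
    unfolding T_def admissible_turns_def
    using bij_betw_branch_angle[OF e, of s "int N - 2 * int (card M)"] assms by auto
  have fin: "finite (T M)" for M
    using bij_betw_finite[OF bij] finite_admissible_turns by blast
  have "card (SIGMA M:Pow {..<N}. T M) = (\<Sum>M\<in>Pow {..<N}. card (T M))"
    using fin by (intro card_SigmaI) auto
  also have "\<dots> = N * ((N - 1) choose ((N - 1) div 2))"
    using bij_betw_same_card[OF bij] sum_card_admissible_turns[OF assms(1)] by simp
  finally show ?thesis
    using bij_betw_finite[OF bij_betw_branch_phasors[OF assms]]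
      bij_betw_same_card[OF bij_betw_branch_phasors[OF assms]] fin
    unfolding T_def[symmetric] by simp
qed

lemma flow_loops_uniform: "flow_loops n (\<lambda>_. 1) = unit_loops n 1 0"
  by (auto simp: flow_loops_def unit_loops_def edge_phasor_def)

section \<open>The two choices of susceptances\<close>

text \<open>The ratio of the strong edge is determined by the others as the inverse of their product. It carries the common
  flow with half the imaginary part, so it lies on one of the two branches of the closing edge.\<close>
lemma bij_betw_flow_loops_one_strong_edge:
  assumes "N \<ge> 1"
  shows "bij_betw (\<lambda>w. restrict w {..<N}) (flow_loops (Suc N) (\<lambda>k. if k = N then 2 else 1))
     (unit_loops N 1 (1/2) \<union> unit_loops N (-1) (1/2))"
proof (rule bij_betw_byWitness[where f' = "\<lambda>w. w(N := cnj (\<Prod>k<N. w k))"])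
  let ?\<beta> = "\<lambda>k. if k = N then 2 else (1::real)"
  have loop: "w \<in> extensional {..<Suc N}" "\<And>k. k \<le> N \<Longrightarrow> norm (w k) = 1" "(\<Prod>k<N. w k) * w N = 1"
      "\<And>k. k < N \<Longrightarrow> Im (w k) = Im (w 0)" "Im (w N) = 1/2 * Im (w 0)"
    if "w \<in> flow_loops (Suc N) ?\<beta>" for w
  proof -
    have all: "\<forall>k<Suc N. ?\<beta> k * Im (w k) = ?\<beta> 0 * Im (w 0)" using that unfolding flow_loops_def by blast
    from all[rule_format, of N] show "Im (w N) = 1/2 * Im (w 0)" using assms by simp
    show "Im (w k) = Im (w 0)" if "k < N" for k using all[rule_format, of k] assms that by simp
    have "\<forall>k<Suc N. norm (w k) = 1" "(\<Prod>k<Suc N. w k) = 1"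
      using that unfolding flow_loops_def by blast+
    then show "(\<Prod>k<N. w k) * w N = 1" by simp
    show "norm (w k) = 1" if "k \<le> N" for k
      using \<open>\<forall>k<Suc N. norm (w k) = 1\<close> that by simp
    show "w \<in> extensional {..<Suc N}" using that unfolding flow_loops_def by blast
  qed
  have unit_half: "\<bar>1/2 * Im z\<bar> < 1" if "norm z = 1" for z
    using abs_Im_le_cmod[of z] that by simp
  have unit_inverse: "cnj p = u" if "p * u = 1" "norm u = 1" for p u
  proof -
    have "norm p * norm u = 1" using that(1) by (simp flip: norm_mult)
    then have "norm p = 1" using that(2) by simp
    then have "p * cnj p = 1" by (rule unit_mult_cnj)
    then show ?thesis using that(1) by (metis mult.assoc mult.commute mult_1)
  qed
  show "\<forall>w\<in>flow_loops (Suc N) ?\<beta>. (restrict w {..<N})(N := cnj (\<Prod>k<N. restrict w {..<N} k)) = w"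
  proof
    fix w assume w: "w \<in> flow_loops (Suc N) ?\<beta>"
    have "cnj (\<Prod>k<N. w k) = w N" using loop(2,3)[OF w] by (intro unit_inverse) auto
    then show "(restrict w {..<N})(N := cnj (\<Prod>k<N. restrict w {..<N} k)) = w"
      using loop(1)[OF w] by (auto simp: fun_eq_iff extensional_def)
  qed
  show "\<forall>w\<in>unit_loops N 1 (1/2) \<union> unit_loops N (-1) (1/2).
      restrict (w(N := cnj (\<Prod>k<N. w k))) {..<N} = w"
    by (auto simp: unit_loops_def extensional_def fun_eq_iff)
  show "(\<lambda>w. restrict w {..<N}) ` flow_loops (Suc N) ?\<beta> \<subseteq> unit_loops N 1 (1/2) \<union> unit_loops N (-1) (1/2)"
  proof (rule image_subsetI)
    fix w assume w: "w \<in> flow_loops (Suc N) ?\<beta>"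
    define s :: real where "s = (if Re (w N) < 0 then -1 else 1)"
    have Nunit: "norm (w N) = 1" and "norm (w 0) = 1" using loop(2)[OF w] by simp_all
    have "\<bar>Im (w N)\<bar> < 1" unfolding loop(5)[OF w] by (rule unit_half) fact
    with Nunit have "w N = edge_phasor s (Im (w N))" unfolding s_def by (rule edge_phasor_unique)
    then have last: "w N = edge_phasor s (1/2 * Im (w 0))" unfolding loop(5)[OF w] .
    have "(\<Prod>k<N. w k) * edge_phasor s (1/2 * Im (w 0)) = 1" using loop(3)[OF w] unfolding last .
    then have "(\<Prod>k<N. restrict w {..<N} k) * edge_phasor s (1/2 * Im (restrict w {..<N} 0)) = 1"
      using assms by simp
    moreover have "\<forall>k<N. norm (restrict w {..<N} k) = 1" using loop(2)[OF w] by simp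
    moreover have "\<forall>k<N. Im (restrict w {..<N} k) = Im (restrict w {..<N} 0)"
    proof (intro allI impI)
      fix k assume "k < N"
      then show "Im (restrict w {..<N} k) = Im (restrict w {..<N} 0)" using loop(4)[OF w, of k] by simp
    qed
    moreover have "restrict w {..<N} \<in> extensional {..<N}" by simp
    ultimately have "restrict w {..<N} \<in> unit_loops N s (1/2)" unfolding unit_loops_def by blast
    then show "restrict w {..<N} \<in> unit_loops N 1 (1/2) \<union> unit_loops N (-1) (1/2)"
      by (auto simp: s_def split: if_splits)
  qed
  show "(\<lambda>w. w(N := cnj (\<Prod>k<N. w k))) ` (unit_loops N 1 (1/2) \<union> unit_loops N (-1) (1/2))
      \<subseteq> flow_loops (Suc N) ?\<beta>"
  proof (rule image_subsetI)
    fix w assume "w \<in> unit_loops N 1 (1/2) \<union> unit_loops N (-1) (1/2)"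
    then obtain s where s: "s = 1 \<or> s = -1" and w: "w \<in> unit_loops N s (1/2)" by blast
    \<comment> \<open>The value at \<open>N\<close> is the closing edge itself, because it is the inverse of the product.\<close>
    let ?u = "edge_phasor s (1/2 * Im (w 0))"
    have props: "w \<in> extensional {..<N}" "\<forall>k<N. norm (w k) = 1" "\<forall>k<N. Im (w k) = Im (w 0)"
      "(\<Prod>k<N. w k) * ?u = 1" using w unfolding unit_loops_def by blast+
    note parts = edge_phasor_parts[OF s unit_half[of "w 0"]]
    have u: "norm ?u = 1" "Im ?u = 1/2 * Im (w 0)" using parts props(2) assms by auto
    have eq: "cnj (\<Prod>k<N. w k) = ?u" using unit_inverse[OF props(4) u(1)] .
    have "w(N := ?u) \<in> extensional {..<Suc N}" using props(1) by (auto simp: extensional_def)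
    moreover have "\<forall>k<Suc N. norm ((w(N := ?u)) k) = 1" using props(2) u(1) by (simp add: less_Suc_eq)
    moreover have "(\<Prod>k<Suc N. (w(N := ?u)) k) = 1" using props(4) by simp
    moreover have "?\<beta> k * Im ((w(N := ?u)) k) = ?\<beta> 0 * Im ((w(N := ?u)) 0)" if "k < Suc N" for k
      using props(3)[rule_format, of k] u(2) assms that by (cases "k = N") auto
    ultimately have "w(N := ?u) \<in> flow_loops (Suc N) ?\<beta>" unfolding flow_loops_def by blast
    then show "w(N := cnj (\<Prod>k<N. w k)) \<in> flow_loops (Suc N) ?\<beta>" unfolding eq .
  qed
qed

lemma unit_loops_signs_disjoint:
  assumes "N \<ge> 1" "\<bar>e\<bar> < 1"
  shows "unit_loops N 1 e \<inter> unit_loops N (-1) e = {}"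
proof (rule ccontr)
  assume "unit_loops N 1 e \<inter> unit_loops N (-1) e \<noteq> {}"
  then obtain w where w: "w \<in> unit_loops N 1 e" "w \<in> unit_loops N (-1) e" by blast
  have "norm (w 0) = 1" using w(1) assms(1) by (simp add: unit_loops_def)
  then have "\<bar>e\<bar> * \<bar>Im (w 0)\<bar> \<le> \<bar>e\<bar> * 1" using abs_Im_le_cmod[of "w 0"] by (intro mult_left_mono) auto
  then have a: "\<bar>e * Im (w 0)\<bar> < 1" using assms(2) by (simp add: abs_mult)
  have "edge_phasor 1 (e * Im (w 0)) = edge_phasor (-1) (e * Im (w 0))"
  proof -
    let ?P = "\<Prod>k<N. w k"
    have eq: "?P * edge_phasor 1 (e * Im (w 0)) = 1" "?P * edge_phasor (-1) (e * Im (w 0)) = 1"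
      using w unfolding unit_loops_def by blast+
    then have "?P \<noteq> 0" by (metis mult_zero_left zero_neq_one)
    then show ?thesis using eq by (metis mult_left_cancel)
  qed
  from arg_cong[OF this, of Re] have "sqrt (1 - (e * Im (w 0))\<^sup>2) = 0"
    using edge_phasor_parts(3)[OF _ a] by simp
  then have "(e * Im (w 0))\<^sup>2 = 1" by simp
  then show False using a by (simp add: abs_square_eq_1)
qed

theorem theorem1:
  fixes n :: nat
  assumes "n \<ge> 3"
  shows "\<exists>b :: nat \<Rightarrow> nat \<Rightarrow> real.
           power_network n (cycle_edges n) b \<and>
           finite (power_flow_solutions n b) \<and>
           card (power_flow_solutions n b) = n * ((n - 1) choose ((n - 1) div 2))"
proof -
  have "\<exists>\<beta>. (\<forall>k<n. \<beta> k \<noteq> 0) \<and> finite (flow_loops n \<beta>) \<and>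
      card (flow_loops n \<beta>) = n * ((n - 1) choose ((n - 1) div 2))"
  proof (cases "odd n")
    case True
    then show ?thesis
      using card_unit_loops[of n 1 0] assms
      by (intro exI[of _ "\<lambda>_. 1"]) (simp add: flow_loops_uniform)
  next
    case False
    then obtain q where "n = 2 * q" by (auto elim: evenE)
    then obtain p where p: "n = 2 * p + 2" using assms that[of "q - 1"] by simp
    define N where "N = 2 * p + 1"
    have N: "n = Suc N" "odd N" "N \<ge> 1" "(N - 1) div 2 = p" "(n - 1) div 2 = p" by (simp_all add: N_def p)
    let ?\<beta> = "\<lambda>k. if k = N then 2 else (1::real)"
    note bij = bij_betw_flow_loops_one_strong_edge[OF N(3)]
    note card = card_unit_loops[OF N(2), of _ "1/2"]
    have fin: "finite (flow_loops n ?\<beta>)"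
      unfolding N(1) using bij_betw_finite[OF bij] card by simp
    have "card (flow_loops n ?\<beta>) = card (unit_loops N 1 (1/2)) + card (unit_loops N (-1) (1/2))"
      unfolding N(1) bij_betw_same_card[OF bij]
      using card unit_loops_signs_disjoint[OF N(3), of "1/2"] by (intro card_Un_disjoint) auto
    also have "\<dots> = 2 * (N * ((N - 1) choose p))"
      using card[of 1] card[of "-1"] N(4) by simp
    also have "\<dots> = n * ((n - 1) choose p)"
    proof -
      \<comment> \<open>With \<open>n = 2 (p + 1)\<close> and \<open>N = 2p + 1\<close>, the two sides are twice those of an absorption identity.\<close>
    have "Suc p * (Suc (2 * p) choose p) = Suc (2 * p) * ((2 * p) choose p)"
        using Suc_times_binomial_add[of p p] binomial_symmetric[of p "Suc (2 * p)"]
          Suc_times_binomial_eq[of "2 * p" p] by (simp add: mult.commute)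
      then show ?thesis by (simp add: N_def p algebra_simps)
    qed
    finally show ?thesis using fin N by (intro exI[of _ ?\<beta>]) auto
  qed
  then obtain \<beta> where \<beta>: "\<And>k. k < n \<Longrightarrow> \<beta> k \<noteq> 0" "finite (flow_loops n \<beta>)"
      "card (flow_loops n \<beta>) = n * ((n - 1) choose ((n - 1) div 2))" by blast
  note bij = bij_betw_solutions_flow_loops[OF assms, of \<beta>]
  show ?thesis
    using power_network_cycle[OF assms, of \<beta>] \<beta> bij_betw_finite[OF bij] bij_betw_same_card[OF bij] by auto
qed

end
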